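(* Let $\vec\Gamma$ be a connected locally finite oriented graph, $M\in\{1,2,\dots\}\cup\{\infty\}$ and $v$ a vertex of $\vec\Gamma$. Then the rooted oriented graph $(\vec\Gamma,v)$ is isomorphic (as a rooted oriented graph) to the connected component of $(v,0)$ in $\vec\Gamma\otimes\vec C_M$, rooted at $(v,0)$, if and only if $\mathrm{der}(\vec\Gamma)\equiv0\pmod M$.
   Context: An oriented graph has vertices, edges and maps $\iota,\tau$; loops and multiple edges allowed; locally finite means every vertex has finitely many outgoing and finitely many incoming edges; connectedness is in the non-oriented sense. The tensor product $\vec\Gamma\otimes\vec\Delta$ has vertex set $V(\vec\Gamma)\times V(\vec\Delta)$ and an edge $(e,f)$ from $(v_1,w_1)$ to $(v_2,w_2)$ for each edge $e\colon v_1\to v_2$ of $\vec\Gamma$ and $f\colon w_1\to w_2$ of $\vec\Delta$. $\vec C_M$ has vertex set $\mathbb Z/M\mathbb Z$ ($\mathbb Z$ if $M=\infty$) and one edge $i\to i+1$ for each $i$. A path in the underlying non-oriented graph is a sequence of edges each traversed either forwards or backwards; its derangement $\mathrm{der}(p)$ is the number of forward steps minus the number of backward steps. $\mathrm{der}(\vec\Gamma)$ is the minimum of $|\mathrm{der}(p)|$ over closed paths $p$ with $\mathrm{der}(p)\ne0$, and $0$ if no such path exists. Congruence modulo $\infty$ means equality. *)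

theory Defs
  imports
    "Graph_Theory.Digraph_Isomorphism"
    "HOL-Library.Extended_Nat"
    "HOL-Number_Theory.Cong"
begin

text \<open>
  Oriented graphs are the digraphs of Graph_Theory satisfying \<^term>\<open>wf_digraph\<close>
  (loops and parallel arcs are allowed): the map \<open>\<iota>\<close> is \<^term>\<open>tail G\<close> and \<open>\<tau>\<close> is \<^term>\<open>head G\<close>.
\<close>

definition locally_finite :: "('a, 'b) pre_digraph \<Rightarrow> bool" where
  "locally_finite G \<longleftrightarrow> (\<forall>v \<in> verts G. finite (out_arcs G v) \<and> finite (in_arcs G v))"

definition tensor_digraph ::
    "('a, 'b) pre_digraph \<Rightarrow> ('c, 'd) pre_digraph \<Rightarrow> ('a \<times> 'c, 'b \<times> 'd) pre_digraph" where
  "tensor_digraph G H =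
    \<lparr> verts = verts G \<times> verts H, arcs = arcs G \<times> arcs H,
      tail = (\<lambda>(e, f). (tail G e, tail H f)), head = (\<lambda>(e, f). (head G e, head H f)) \<rparr>"

text \<open>
  Elements of \<open>\<int>/M\<int>\<close> are represented by \<open>0, \<dots>, M - 1\<close>. The unique arc leaving a vertex is
  identified with that vertex.
\<close>

definition cycle_digraph :: "enat \<Rightarrow> (int, int) pre_digraph" where
  "cycle_digraph M = (case M of
      enat m \<Rightarrow> \<lparr> verts = {0..<int m}, arcs = {0..<int m},
                 tail = (\<lambda>i. i), head = (\<lambda>i. (i + 1) mod int m) \<rparr>
    | \<infinity> \<Rightarrow> \<lparr> verts = UNIV, arcs = UNIV, tail = (\<lambda>i. i), head = (\<lambda>i. i + 1) \<rparr>)"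

text \<open>
  The connectedness relation is the one underlying \<^const>\<open>Digraph_Component.connected\<close>; the
  parallel arcs that \<^const>\<open>mk_symmetric\<close> drops are kept in the component.
\<close>

definition component_of :: "('a, 'b) pre_digraph \<Rightarrow> 'a \<Rightarrow> ('a, 'b) pre_digraph" where
  "component_of G v = G \<restriction> {u. v \<rightarrow>\<^sup>*\<^bsub>with_proj (mk_symmetric G)\<^esub> u}"

text \<open>\<^const>\<open>digraph_iso\<close> with the additional requirement that the root is mapped to the root.\<close>

definition rooted_digraph_iso ::
    "('a, 'b) pre_digraph \<Rightarrow> 'a \<Rightarrow> ('c, 'd) pre_digraph \<Rightarrow> 'c \<Rightarrow> bool" where
  "rooted_digraph_iso G v H w \<longleftrightarrow>
    (\<exists>f. pre_digraph.digraph_isomorphism G f \<and> H = app_iso f G \<and> iso_verts f v = w)"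

datatype 'b step = Forward 'b | Backward 'b

fun underlying_path :: "('a, 'b) pre_digraph \<Rightarrow> 'a \<Rightarrow> 'b step list \<Rightarrow> 'a \<Rightarrow> bool" where
  "underlying_path G u [] w \<longleftrightarrow> u \<in> verts G \<and> u = w"
| "underlying_path G u (Forward e # p) w \<longleftrightarrow>
    e \<in> arcs G \<and> tail G e = u \<and> underlying_path G (head G e) p w"
| "underlying_path G u (Backward e # p) w \<longleftrightarrow>
    e \<in> arcs G \<and> head G e = u \<and> underlying_path G (tail G e) p w"

fun path_derangement :: "'b step list \<Rightarrow> int" where
  "path_derangement [] = 0"
| "path_derangement (Forward e # p) = path_derangement p + 1"
| "path_derangement (Backward e # p) = path_derangement p - 1"

definition derangement :: "('a, 'b) pre_digraph \<Rightarrow> nat" where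
  "derangement G =
    (let D = {nat \<bar>path_derangement p\<bar> | p u. underlying_path G u p u \<and> path_derangement p \<noteq> 0}
     in if D = {} then 0 else (LEAST d. d \<in> D))"

definition cong_enat :: "nat \<Rightarrow> nat \<Rightarrow> enat \<Rightarrow> bool" where
  "cong_enat a b M \<longleftrightarrow> (case M of enat m \<Rightarrow> [a = b] (mod m) | \<infinity> \<Rightarrow> a = b)"

end

(*
  A path of G starting at v lifts to the tensor product starting at (v, 0), and its lift ends over
  the residue of its derangement modulo M. Hence the component of (v, 0) consists of the pairs
  (w, der p mod M) for paths p from v to w. If all closed paths have derangement divisible by M,
  this residue depends on w only, and w \<mapsto> (w, der p mod M) is the isomorphism. Conversely, an
  isomorphism sends a closed path to a closed path with the same derangement, and the projection
  to the cycle shows that M divides it. Finally, derangements of closed paths at a vertex form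
  a subgroup of the integers that is the same at all vertices, so it is generated by der G.
*)
theory Submission
  imports Defs
begin

lemma tensor_digraph_simps [simp]:
  "verts (tensor_digraph G H) = verts G \<times> verts H"
  "arcs (tensor_digraph G H) = arcs G \<times> arcs H"
  "tail (tensor_digraph G H) x = (tail G (fst x), tail H (snd x))"
  "head (tensor_digraph G H) x = (head G (fst x), head H (snd x))"
  by (auto simp: tensor_digraph_def split: prod.splits)

lemma wf_digraph_tensor_digraph:
  "wf_digraph G \<Longrightarrow> wf_digraph H \<Longrightarrow> wf_digraph (tensor_digraph G H)"
  by (auto simp: wf_digraph_def)

section \<open>Paths in the underlying non-oriented graph\<close>

fun inverse_step :: "'b step \<Rightarrow> 'b step" where
  "inverse_step (Forward e) = Backward e"
| "inverse_step (Backward e) = Forward e"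

lemma underlying_path_append:
  "underlying_path G u p w \<Longrightarrow> underlying_path G w q x \<Longrightarrow> underlying_path G u (p @ q) x"
  by (induction G u p w rule: underlying_path.induct) auto

lemma path_derangement_append:
  "path_derangement (p @ q) = path_derangement p + path_derangement q"
  by (induction p rule: path_derangement.induct) auto

lemma path_derangement_inverse:
  "path_derangement (rev (map inverse_step p)) = - path_derangement p"
  by (induction p rule: path_derangement.induct) (auto simp: path_derangement_append)

lemma path_derangement_map: "path_derangement (map (map_step f) p) = path_derangement p"
  by (induction p rule: path_derangement.induct) auto

text \<open>Homomorphisms carry paths along step by step. This serves for both projections of the
  tensor product and for a given isomorphism.\<close>

lemma underlying_path_map:
  assumes "underlying_path G u p w"
    and "\<And>x. x \<in> verts G \<Longrightarrow> f x \<in> verts H"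
    and "\<And>e. e \<in> arcs G \<Longrightarrow> g e \<in> arcs H \<and> tail H (g e) = f (tail G e) \<and> head H (g e) = f (head G e)"
  shows "underlying_path H (f u) (map (map_step g) p) (f w)"
  using assms by (induction G u p w rule: underlying_path.induct) auto

context wf_digraph
begin

lemma underlying_path_in_verts:
  "underlying_path G u p w \<Longrightarrow> u \<in> verts G \<and> w \<in> verts G"
  by (induction p arbitrary: u rule: path_derangement.induct) auto

lemma underlying_path_inverse:
  "underlying_path G u p w \<Longrightarrow> underlying_path G w (rev (map inverse_step p)) u"
proof (induction p arbitrary: u rule: path_derangement.induct)
  case (2 e p)
  then show ?case by (auto intro!: underlying_path_append)
next
  case (3 e p)
  then show ?case by (auto intro!: underlying_path_append)
qed auto

text \<open>Bridges reachability along symmetrised pairs of vertices, by which connectedness and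
  components are defined, to lists of steps, which retain the arcs and hence the
  derangement.\<close>

lemma reachable_mk_symmetric_iff_underlying_path:
  "u \<rightarrow>\<^sup>*\<^bsub>with_proj (mk_symmetric G)\<^esub> w \<longleftrightarrow> (\<exists>p. underlying_path G u p w)"
proof
  interpret S: pair_wf_digraph "mk_symmetric G" by (rule wellformed_mk_symmetric)
  show "\<exists>p. underlying_path G u p w" if "u \<rightarrow>\<^sup>*\<^bsub>with_proj (mk_symmetric G)\<^esub> w"
    using that
  proof (induction rule: S.converse_reachable_induct)
    case base
    then have "underlying_path G w [] w" by simp
    then show ?case ..
  next
    case (step x y)
    then obtain p where p: "underlying_path G y p w" by blast
    \<comment> \<open>A symmetrised pair records neither an arc nor its direction; both are
      recovered here.\<close>
    from step(1) obtain e where "e \<in> arcs G"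
      "x = tail G e \<and> y = head G e \<or> x = head G e \<and> y = tail G e"
      by (auto simp: parcs_mk_symmetric)
    with p have "underlying_path G x (Forward e # p) w \<or> underlying_path G x (Backward e # p) w"
      by auto
    then show ?case by blast
  qed
  have edge: "(tail G e, head G e) \<in> parcs (mk_symmetric G)"
    "(head G e, tail G e) \<in> parcs (mk_symmetric G)" if "e \<in> arcs G" for e
    using that by (auto simp: parcs_mk_symmetric)
  have "u \<rightarrow>\<^sup>*\<^bsub>with_proj (mk_symmetric G)\<^esub> w" if "underlying_path G u p w" for p
    using that
  proof (induction p arbitrary: u rule: path_derangement.induct)
    case 1
    then show ?case by (auto simp: reachable_def)
  next
    case (2 e p)
    then show ?case using S.adj_reachable_trans[OF edge(1)] by auto
  next
    case (3 e p)
    then show ?case using S.adj_reachable_trans[OF edge(2)] by auto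
  qed
  then show "u \<rightarrow>\<^sup>*\<^bsub>with_proj (mk_symmetric G)\<^esub> w" if "\<exists>p. underlying_path G u p w"
    using that by blast
qed

lemma connected_underlying_path:
  assumes "connected G" "u \<in> verts G" "w \<in> verts G"
  obtains p where "underlying_path G u p w"
proof -
  have "u \<rightarrow>\<^sup>*\<^bsub>with_proj (mk_symmetric G)\<^esub> w"
    using assms by (auto simp: connected_def strongly_connected_def)
  then show ?thesis
    using that unfolding reachable_mk_symmetric_iff_underlying_path by blast
qed

section \<open>Derangements of closed paths\<close>

lemma closed_path_derangement_multiple:
  assumes "underlying_path G u p u"
  shows "\<exists>q. underlying_path G u q u \<and> path_derangement q = k * path_derangement p"
proof (induction k rule: int_induct[where k = 0])
  case base
  have "underlying_path G u [] u" using underlying_path_in_verts[OF assms] by simp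
  then show ?case by (intro exI[of _ "[]"]) simp
next
  case (step1 k)
  then show ?case
    using underlying_path_append[OF assms] path_derangement_append[of p]
    by (fastforce simp: algebra_simps)
next
  case (step2 k)
  then show ?case
    using underlying_path_append[OF underlying_path_inverse[OF assms]]
      path_derangement_append[of "rev (map inverse_step p)"] path_derangement_inverse[of p]
    by (fastforce simp: algebra_simps)
qed

text \<open>Euclidean division: a closed path \<open>q\<close> of least nonzero absolute derangement
  is transported to \<open>u\<close>, and a multiple of it is subtracted from \<open>p\<close>. The
  remainder is smaller than the minimum, so it vanishes.\<close>

lemma derangement_dvd_closed_path:
  assumes conn: "connected G" and p: "underlying_path G u p u"
  shows "int (derangement G) dvd path_derangement p"
proof (cases "path_derangement p = 0")
  case False
  define D where "D = {nat \<bar>path_derangement p\<bar> | p u.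
    underlying_path G u p u \<and> path_derangement p \<noteq> 0}"
  have "nat \<bar>path_derangement p\<bar> \<in> D" using p False by (auto simp: D_def)
  then have der: "derangement G = (LEAST d. d \<in> D)" and "derangement G \<in> D"
    unfolding derangement_def D_def[symmetric] by (auto simp: Let_def intro: LeastI)
  then obtain q w where q: "underlying_path G w q w" "path_derangement q \<noteq> 0"
    and der_q: "derangement G = nat \<bar>path_derangement q\<bar>"
    by (auto simp: D_def)
  obtain c where c: "underlying_path G u c w"
    using connected_underlying_path[OF conn] underlying_path_in_verts p q by metis
  obtain r where r: "underlying_path G w r w"
    "path_derangement r = - (path_derangement p div path_derangement q) * path_derangement q"
    using closed_path_derangement_multiple[OF q(1)] by blast
  \<comment> \<open>The contributions of \<open>c\<close> and its inverse cancel, so the derangement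
    of \<open>s\<close> is that of \<open>p\<close> modulo that of \<open>q\<close>.\<close>
  define s where "s = p @ c @ r @ rev (map inverse_step c)"
  have s: "underlying_path G u s u"
    unfolding s_def
    by (intro underlying_path_append[OF p] underlying_path_append[OF c]
        underlying_path_append[OF r(1)] underlying_path_inverse[OF c])
  have der_s: "path_derangement s = path_derangement p mod path_derangement q"
    by (simp add: s_def path_derangement_append path_derangement_inverse r(2)
        minus_div_mult_eq_mod[symmetric])
  have "path_derangement s = 0"
  proof (rule ccontr)
    assume "path_derangement s \<noteq> 0"
    with s have "nat \<bar>path_derangement s\<bar> \<in> D" by (auto simp: D_def)
    then have "derangement G \<le> nat \<bar>path_derangement s\<bar>"
      unfolding der by (rule Least_le)
    moreover have "\<bar>path_derangement s\<bar> < \<bar>path_derangement q\<bar>"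
      unfolding der_s using q(2) by (rule abs_mod_less)
    ultimately show False using der_q by linarith
  qed
  then show ?thesis by (simp add: der_s der_q mod_eq_0_iff_dvd)
qed simp

lemma dvd_derangement_iff:
  assumes "connected G"
  shows "m dvd int (derangement G) \<longleftrightarrow>
    (\<forall>u p. underlying_path G u p u \<longrightarrow> m dvd path_derangement p)"
proof
  assume "m dvd int (derangement G)"
  then show "\<forall>u p. underlying_path G u p u \<longrightarrow> m dvd path_derangement p"
    using derangement_dvd_closed_path[OF assms] dvd_trans by blast
next
  define D where "D = {nat \<bar>path_derangement p\<bar> | p u.
    underlying_path G u p u \<and> path_derangement p \<noteq> 0}"
  assume dvd: "\<forall>u p. underlying_path G u p u \<longrightarrow> m dvd path_derangement p"
  \<comment> \<open>If no closed path has nonzero derangement, the default \<open>0\<close> is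
    divisible by everything; otherwise the minimum is attained.\<close>
  have "derangement G = 0 \<or> derangement G \<in> D"
    unfolding derangement_def D_def[symmetric] by (auto simp: Let_def intro: LeastI)
  then show "m dvd int (derangement G)" using dvd by (auto simp: D_def)
qed

end

section \<open>Lifting paths to the tensor product with a cycle\<close>

text \<open>
  Since \<open>k mod 0 = k\<close> and \<open>0 dvd k \<longleftrightarrow> k = 0\<close>, encoding \<open>\<infinity>\<close> as \<open>0\<close> makes
  the infinite path the instance \<open>m = 0\<close> of the finite cycles.
\<close>

definition period :: "enat \<Rightarrow> int" where
  "period M = (case M of enat m \<Rightarrow> int m | \<infinity> \<Rightarrow> 0)"

lemma cong_enat_0_iff: "cong_enat a 0 M \<longleftrightarrow> period M dvd int a"
  by (auto simp: cong_enat_def period_def cong_0_iff split: enat.splits)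

text \<open>Written with residues so that period \<open>0\<close> yields all integers. The
  assumption excludes \<open>enat 0\<close>, whose period is also \<open>0\<close> but whose cycle
  is empty.\<close>

lemma cycle_digraph_simps:
  assumes "M \<ge> 1"
  shows "verts (cycle_digraph M) = range (\<lambda>k. k mod period M)"
    and "arcs (cycle_digraph M) = range (\<lambda>k. k mod period M)"
    and "tail (cycle_digraph M) i = i"
    and "head (cycle_digraph M) i = (i + 1) mod period M"
proof -
  have range: "range (\<lambda>k. k mod int m) = {0..<int m}" if "m \<ge> 1" for m
  proof (intro equalityI subsetI)
    fix i assume "i \<in> {0..<int m}"
    then have "i = i mod int m" by simp
    then show "i \<in> range (\<lambda>k. k mod int m)" by (rule range_eqI)
  qed (use that in auto)
  show "verts (cycle_digraph M) = range (\<lambda>k. k mod period M)"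
    "arcs (cycle_digraph M) = range (\<lambda>k. k mod period M)"
    using assms range
    by (auto simp: cycle_digraph_def period_def one_enat_def split: enat.splits)
  show "tail (cycle_digraph M) i = i" "head (cycle_digraph M) i = (i + 1) mod period M"
    by (auto simp: cycle_digraph_def period_def split: enat.splits)
qed

lemma wf_digraph_cycle_digraph: "M \<ge> 1 \<Longrightarrow> wf_digraph (cycle_digraph M)"
  by (auto simp: wf_digraph_def cycle_digraph_simps)

lemma underlying_path_cycle_digraph:
  assumes "M \<ge> 1" "underlying_path (cycle_digraph M) i p j"
  shows "j = (i + path_derangement p) mod period M"
  using assms(2)
proof (induction p arbitrary: i rule: path_derangement.induct)
  case 1
  then show ?case by (auto simp: cycle_digraph_simps[OF assms(1)])
next
  case (2 e p)
  then have "j = ((e + 1) mod period M + path_derangement p) mod period M" "i = e"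
    by (auto simp: cycle_digraph_simps[OF assms(1)])
  then show ?case by (simp add: mod_simps algebra_simps)
next
  case (3 e p)
  then have "j = (e + path_derangement p) mod period M" "i = (e + 1) mod period M"
    by (auto simp: cycle_digraph_simps[OF assms(1)])
  then show ?case
    using mod_add_left_eq[of "e + 1" "period M" "path_derangement p - 1"]
    by (simp add: algebra_simps)
qed

lemma underlying_path_tensor_fst:
  "underlying_path (tensor_digraph G H) x p y \<Longrightarrow>
    underlying_path G (fst x) (map (map_step fst) p) (fst y)"
  by (rule underlying_path_map) auto

lemma underlying_path_tensor_snd:
  "underlying_path (tensor_digraph G H) x p y \<Longrightarrow>
    underlying_path H (snd x) (map (map_step snd) p) (snd y)"
  by (rule underlying_path_map) auto

lemma underlying_path_tensor_cycle_snd: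
  assumes "M \<ge> 1" "underlying_path (tensor_digraph G (cycle_digraph M)) x p y"
  shows "snd y = (snd x + path_derangement p) mod period M"
  using underlying_path_cycle_digraph[OF assms(1) underlying_path_tensor_snd[OF assms(2)]]
  by (simp add: path_derangement_map)

text \<open>Each vertex of the cycle has exactly one outgoing and one incoming arc, so every step
  lifts. An arbitrary integer \<open>i\<close> is allowed so that the induction can pass to
  \<open>i + 1\<close> and \<open>i - 1\<close>.\<close>

lemma underlying_path_lift:
  assumes M: "M \<ge> 1" and "underlying_path G u p w"
  shows "\<exists>q. underlying_path (tensor_digraph G (cycle_digraph M))
    (u, i mod period M) q (w, (i + path_derangement p) mod period M)"
  using assms(2)
proof (induction p arbitrary: u i rule: path_derangement.induct)
  case 1
  then show ?case
    by (intro exI[of _ "[]"]) (auto simp: cycle_digraph_simps[OF M])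
next
  case (2 e p)
  then obtain q where "underlying_path (tensor_digraph G (cycle_digraph M))
    (head G e, (i + 1) mod period M) q (w, (i + 1 + path_derangement p) mod period M)"
    by fastforce
  then show ?case using 2(2)
    by (intro exI[of _ "Forward (e, i mod period M) # q"])
      (auto simp: cycle_digraph_simps[OF M] mod_simps algebra_simps)
next
  case (3 e p)
  then obtain q where "underlying_path (tensor_digraph G (cycle_digraph M))
    (tail G e, (i - 1) mod period M) q (w, (i - 1 + path_derangement p) mod period M)"
    by fastforce
  \<comment> \<open>An arc of the cycle is named by its tail, so the one entering \<open>i\<close>
    is \<open>i - 1\<close>, up to residues.\<close>
  then show ?case using 3(2)
    by (intro exI[of _ "Backward (e, (i - 1) mod period M) # q"])
      (auto simp: cycle_digraph_simps[OF M] mod_simps algebra_simps)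
qed

text \<open>Projecting a path to \<open>G\<close> and reading off its final second coordinate gives
  one inclusion; lifting from \<open>0\<close> gives the other.\<close>

lemma verts_component_of_tensor_cycle:
  assumes "wf_digraph G" and M: "M \<ge> 1"
  shows "verts (component_of (tensor_digraph G (cycle_digraph M)) (v, 0)) =
    {(w, path_derangement p mod period M) | w p. underlying_path G v p w}"
proof -
  let ?T = "tensor_digraph G (cycle_digraph M)"
  interpret T: wf_digraph ?T
    using assms by (intro wf_digraph_tensor_digraph wf_digraph_cycle_digraph)
  have "verts (component_of ?T (v, 0)) = {x. \<exists>p. underlying_path ?T (v, 0) p x}"
    by (simp add: component_of_def T.reachable_mk_symmetric_iff_underlying_path)
  also have "\<dots> = {(w, path_derangement p mod period M) | w p. underlying_path G v p w}"
  proof (intro set_eqI iffI)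
    fix x assume "x \<in> {x. \<exists>p. underlying_path ?T (v, 0) p x}"
    then obtain p where p: "underlying_path ?T (v, 0) p x" by blast
    from underlying_path_tensor_fst[OF p] underlying_path_tensor_cycle_snd[OF M p]
    show "x \<in> {(w, path_derangement p mod period M) | w p. underlying_path G v p w}"
      by (cases x) (auto simp: path_derangement_map
          intro!: exI[of _ "map (map_step fst) p"])
  next
    fix x assume "x \<in> {(w, path_derangement p mod period M) | w p. underlying_path G v p w}"
    then show "x \<in> {x. \<exists>p. underlying_path ?T (v, 0) p x}"
      using underlying_path_lift[OF M, of G v _ _ 0] by auto
  qed
  finally show ?thesis .
qed

section \<open>Comparing the graph with the component of the root\<close>

theorem theorem3p8:
  fixes G :: "('a, 'b) pre_digraph" and M :: enat and v :: 'a
  assumes "wf_digraph G"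
    and "Digraph_Component.connected G"
    and "locally_finite G"
    and "M \<ge> 1"
    and "v \<in> verts G"
  shows "rooted_digraph_iso G v
           (component_of (tensor_digraph G (cycle_digraph M)) (v, 0)) (v, 0)
         \<longleftrightarrow> cong_enat (derangement G) 0 M"
proof -
  interpret wf_digraph G by fact
  note M = \<open>M \<ge> 1\<close>
  let ?m = "period M"
  let ?T = "tensor_digraph G (cycle_digraph M)"
  let ?K = "component_of ?T (v, 0)"
  interpret T: wf_digraph ?T
    using assms by (intro wf_digraph_tensor_digraph wf_digraph_cycle_digraph)
  have verts_K: "verts ?K = {(w, path_derangement p mod ?m) | w p. underlying_path G v p w}"
    using assms by (intro verts_component_of_tensor_cycle)
  have verts_K_T: "verts ?K \<subseteq> verts ?T"
    using verts_K underlying_path_in_verts by (auto simp: cycle_digraph_simps[OF M])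
  have arcs_K: "arcs ?K = {x \<in> arcs ?T. tail ?T x \<in> verts ?K \<and> head ?T x \<in> verts ?K}"
    and ends_K: "tail ?K = tail ?T" "head ?K = head ?T"
    by (auto simp: component_of_def)
  have "rooted_digraph_iso G v ?K (v, 0) \<longleftrightarrow>
    (\<forall>u p. underlying_path G u p u \<longrightarrow> ?m dvd path_derangement p)"
  proof
    assume "rooted_digraph_iso G v ?K (v, 0)"
    then obtain f where f: "digraph_isomorphism f" "?K = app_iso f G"
      by (auto simp: rooted_digraph_iso_def)
    show "\<forall>u p. underlying_path G u p u \<longrightarrow> ?m dvd path_derangement p"
    proof (intro allI impI)
      fix u p assume p: "underlying_path G u p u"
      \<comment> \<open>Seen as a map into the whole product, \<open>f\<close> is a homomorphism, so
        it preserves paths and their derangements.\<close>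
      have v_im: "iso_verts f x \<in> verts ?T" if "x \<in> verts G" for x
      proof -
        have "iso_verts f x \<in> verts ?K" using that f(2) by simp
        then show ?thesis using verts_K_T by blast
      qed
      have a_im: "iso_arcs f e \<in> arcs ?T \<and> tail ?T (iso_arcs f e) = iso_verts f (tail G e) \<and>
        head ?T (iso_arcs f e) = iso_verts f (head G e)" if "e \<in> arcs G" for e
      proof -
        have "iso_arcs f e \<in> arcs ?K" using that f(2) by simp
        then have "iso_arcs f e \<in> arcs ?T" unfolding arcs_K by blast
        moreover have "tail ?T = iso_tail f" "head ?T = iso_head f"
          using ends_K f(2) by simp_all
        ultimately show ?thesis
          using iso_verts_tail[OF f(1) that] iso_verts_head[OF f(1) that] by metis
      qed
      have q: "underlying_path ?T (iso_verts f u) (map (map_step (iso_arcs f)) p) (iso_verts f u)"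
        using p v_im a_im by (rule underlying_path_map)
      \<comment> \<open>The image of \<open>p\<close> is closed, so shifting this coordinate by the
        derangement fixes it modulo the period.\<close>
      let ?i = "snd (iso_verts f u)"
      have "?i = (?i + path_derangement p) mod ?m"
        using underlying_path_tensor_cycle_snd[OF M q] by (simp add: path_derangement_map)
      then have "?i mod ?m = (?i + path_derangement p) mod ?m" by (metis mod_mod_trivial)
      then show "?m dvd path_derangement p" by (simp add: mod_eq_dvd_iff)
    qed
  next
    assume closed: "\<forall>u p. underlying_path G u p u \<longrightarrow> ?m dvd path_derangement p"
    \<comment> \<open>The choice of path is harmless: one path followed by the inverse of another is
      closed, so the period divides the difference of their derangements.\<close>
    define h where "h w = path_derangement (SOME p. underlying_path G v p w) mod ?m" for w
    have h: "path_derangement p mod ?m = h w" if p: "underlying_path G v p w" for p w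
    proof -
      define q where "q = (SOME p. underlying_path G v p w)"
      have "underlying_path G v q w" unfolding q_def using p by (rule someI)
      then have "underlying_path G v (p @ rev (map inverse_step q)) v"
        by (intro underlying_path_append[OF p] underlying_path_inverse)
      then have "?m dvd path_derangement (p @ rev (map inverse_step q))"
        using closed by blast
      then show ?thesis
        by (simp add: path_derangement_append path_derangement_inverse mod_eq_dvd_iff
            h_def q_def[symmetric])
    qed
    have path: "\<exists>p. underlying_path G v p w" if "w \<in> verts G" for w
      using connected_underlying_path assms(2,5) that by metis
    \<comment> \<open>The vertex set of the component is thus the graph of the function
      \<open>h\<close>.\<close>
    have verts_K': "verts ?K = (\<lambda>w. (w, h w)) ` verts G"
    proof (intro equalityI subsetI)
      fix x assume "x \<in> verts ?K"
      then obtain w p where "underlying_path G v p w" "x = (w, path_derangement p mod ?m)"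
        unfolding verts_K by blast
      then show "x \<in> (\<lambda>w. (w, h w)) ` verts G"
        using h underlying_path_in_verts by simp
    next
      fix x assume "x \<in> (\<lambda>w. (w, h w)) ` verts G"
      then obtain w where "w \<in> verts G" and x: "x = (w, h w)" by blast
      then obtain p where p: "underlying_path G v p w" using path by blast
      with x h[OF p] show "x \<in> verts ?K"
        unfolding verts_K by (auto intro!: exI[of _ p])
    qed
    have h_range: "h w \<in> range (\<lambda>k. k mod ?m)" for w by (simp add: h_def)
    have h_head: "h (head G e) = (h (tail G e) + 1) mod ?m" if e: "e \<in> arcs G" for e
    proof -
      obtain p where p: "underlying_path G v p (tail G e)" using path tail_in_verts[OF e] by blast
      have "underlying_path G v (p @ [Forward e]) (head G e)"
        using e by (intro underlying_path_append[OF p]) auto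
      from h[OF this] h[OF p, symmetric] show ?thesis
        by (simp add: path_derangement_append mod_simps)
    qed
    \<comment> \<open>An arc of the cycle equals its tail, which forces the second coordinate of the
      arc map. The full \<open>head ?T\<close> and \<open>tail ?T\<close> are stored because
      \<open>?K = app_iso ?f G\<close> compares functions, not only their values on arcs.\<close>
    let ?f = "\<lparr>iso_verts = (\<lambda>w. (w, h w)), iso_arcs = (\<lambda>e. (e, h (tail G e))),
      iso_head = head ?T, iso_tail = tail ?T\<rparr>"
    have "digraph_isomorphism ?f"
      using h_head wf_digraph
      by (auto simp: digraph_isomorphism_def cycle_digraph_simps[OF M] inj_on_def)
    moreover have "?K = app_iso ?f G"
    proof (rule pre_digraph.equality)
      \<comment> \<open>By \<open>verts_K'\<close>, the tail of an arc \<open>(e, i)\<close> lies in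
        the component only if \<open>i = h (tail G e)\<close>; \<open>h_head\<close> then puts its
        head there too.\<close>
      show "arcs ?K = arcs (app_iso ?f G)"
        unfolding arcs_K verts_K' using h_head h_range
        by (auto simp: cycle_digraph_simps[OF M] image_iff)
    qed (simp_all add: verts_K' ends_K)
    moreover have "h v = 0"
      using h[of "[]" v] assms(5) by simp
    ultimately show "rooted_digraph_iso G v ?K (v, 0)"
      unfolding rooted_digraph_iso_def by (intro exI[of _ ?f]) simp
  qed
  also have "\<dots> \<longleftrightarrow> cong_enat (derangement G) 0 M"
    by (simp add: cong_enat_0_iff dvd_derangement_iff[OF assms(2)])
  finally show ?thesis .
qed

end
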